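(* (1) (One-dimensional case.) Let $a<b$ be real numbers. For each $n$ let $x_0=x_0^{(n)}<b$, $h=(b-x_0)/(n+1)$ and $x_1=x_0+h$ be such that $x_0<a<x_1$, and let $\vartheta=(x_1-a)/h\in(0,1)$. Let $A_h\in\mathbb{R}^{(n+1)\times(n+1)}$ be the one-dimensional Coco--Russo matrix with parameters $n,h,\vartheta$ (defined in the context). Then, as $n\to\infty$, $$\{h^2A_h\}\sim_\lambda 2-2\cos(\theta),\qquad \theta\in[-\pi,\pi].$$ (2) (Two-dimensional case.) For each $n$ let $h=1/(n+1)$, let $0<a<h$ (where $a=a^{(n)}$ is allowed to depend on $n$), and let $\vartheta_S=(h-a)/h\in(0,1)$. Let $A_h\in\mathbb{R}^{n(n+1)\times n(n+1)}$ be the two-dimensional Coco--Russo matrix with parameters $n,h,\vartheta_S$ (defined in the context). Then, as $n\to\infty$, $$\{h^2A_h\}\sim_\lambda 4-2\cos(\theta_1)-2\cos(\theta_2),\qquad (\theta_1,\theta_2)\in[-\pi,\pi]^2.$$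
   Context: Spectral distribution: let $\{M_n\}_n$ be a sequence of square matrices, $M_n$ of size $d_n$ with $d_n\to\infty$, and let $f:D\subset\mathbb{R}^t\to\mathbb{C}$ be a measurable function on a set $D$ with Lebesgue measure $0<\mu_t(D)<\infty$. One writes $\{M_n\}_n\sim_\lambda f$ if $$\lim_{n\to\infty}\frac1{d_n}\sum_{i=1}^{d_n}F(\lambda_i(M_n))=\frac1{\mu_t(D)}\int_D F(f(\mathbf{x}))\,d\mathbf{x}\qquad\text{for all }F\in C_c(\mathbb{C}),$$ where $\lambda_1(M_n),\dots,\lambda_{d_n}(M_n)$ are the eigenvalues of $M_n$ (with algebraic multiplicity) and $C_c(\mathbb{C})$ is the space of continuous complex-valued functions on $\mathbb{C}$ with compact support. One-dimensional Coco--Russo matrix. This is the coefficient matrix of the finite difference discretization of $-u''=f$ on $(a,b)$ with Dirichlet boundary conditions, on the uniform grid $x_i=x_0+ih$, $i=0,\dots,n+1$, with $x_0<a<x_1$ and $x_{n+1}=b$; the condition at $b$ is eliminated, and the condition at $a$ is imposed by linear interpolation between $x_0$ and $x_1$. Explicitly, indexing rows and columns by $0,1,\dots,n$: - row $0$ has entries $(A_h)_{0,0}=\vartheta$, $(A_h)_{0,1}=1-\vartheta$, and zeros elsewhere; - for $1\le i\le n$, row $i$ has entries $(A_h)_{i,i-1}=-1/h^2$, $(A_h)_{i,i}=2/h^2$, $(A_h)_{i,i+1}=-1/h^2$ (the last one only if $i\le n-1$), and zeros elsewhere. Two-dimensional Coco--Russo matrix. This is the coefficient matrix of the analogous discretization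 of $-u_{xx}-u_{yy}=f$ on $[0,1]\times[a,1]$ with Dirichlet boundary conditions, on the grid $(ih,jh)$; the conditions on $x=0$, $x=1$, $y=1$ are eliminated, and the condition on $y=a$ is imposed by linear interpolation between the rows $y=0$ and $y=h$. Let $\mathbb{I}_n$ be the $n\times n$ identity matrix, $B=-\frac1{h^2}\mathbb{I}_n$, and let $G\in\mathbb{R}^{n\times n}$ be $\frac1{h^2}$ times the tridiagonal matrix with $4$ on the main diagonal and $-1$ on the first sub- and superdiagonals. Then $A_h$ is an $(n+1)\times(n+1)$ block matrix with $n\times n$ blocks, indexed by $0,1,\dots,n$: - block row $0$ has block $\vartheta_S\mathbb{I}_n$ in block column $0$, block $(1-\vartheta_S)\mathbb{I}_n$ in block column $1$, and zero blocks elsewhere; - for $1\le j\le n$, block row $j$ has $B$ in block column $j-1$, $G$ in block column $j$, $B$ in block column $j+1$ (the last one only if $j\le n-1$), and zero blocks elsewhere. *)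

theory Defs
  imports
    "HOL-Analysis.Analysis"
    "HOL-Computational_Algebra.Polynomial"
    "Jordan_Normal_Form.Char_Poly"
begin

definition C_c :: "(complex \<Rightarrow> complex) set" where
  "C_c = {F. continuous_on UNIV F \<and> compact (closure {z. F z \<noteq> 0})}"

text \<open>
  The eigenvalues of a matrix, counted with algebraic multiplicity: the multiset of roots of the
  characteristic polynomial. For a complex square matrix its size is the dimension of the matrix.
\<close>

definition eigvals_mset :: "complex mat \<Rightarrow> complex multiset" where
  "eigvals_mset A = proots (char_poly A)"

text \<open>
  The standing assumptions (square matrices of diverging size, a measurable symbol on a domain of
  positive finite Lebesgue measure) are part of the predicate.
\<close>

definition spectral_distr ::
    "(nat \<Rightarrow> complex mat) \<Rightarrow> ('a::euclidean_space \<Rightarrow> complex) \<Rightarrow> 'a set \<Rightarrow> bool" where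
  "spectral_distr M f D \<longleftrightarrow>
     (\<forall>n. square_mat (M n)) \<and>
     filterlim (\<lambda>n. dim_row (M n)) at_top sequentially \<and>
     D \<in> lmeasurable \<and> measure lebesgue D > 0 \<and>
     f \<in> borel_measurable (lebesgue_on D) \<and>
     (\<forall>F\<in>C_c.
        (\<lambda>n. (\<Sum>z\<in>#eigvals_mset (M n). F z) / of_nat (dim_row (M n)))
          \<longlonglongrightarrow> (LINT x|lebesgue_on D. F (f x)) / of_real (measure lebesgue D))"

definition coco_russo_1d :: "nat \<Rightarrow> real \<Rightarrow> real \<Rightarrow> real mat" where
  "coco_russo_1d n h \<theta> = mat (n + 1) (n + 1) (\<lambda>(i, j).
     if i = 0 then
       (if j = 0 then \<theta> else if j = 1 then 1 - \<theta> else 0)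
     else if j + 1 = i then - (1 / h^2)
     else if j = i then 2 / h^2
     else if j = i + 1 then - (1 / h^2)
     else 0)"

definition cr_B :: "nat \<Rightarrow> real \<Rightarrow> real mat" where
  "cr_B n h = (- (1 / h^2)) \<cdot>\<^sub>m 1\<^sub>m n"

definition cr_G :: "nat \<Rightarrow> real \<Rightarrow> real mat" where
  "cr_G n h = (1 / h^2) \<cdot>\<^sub>m mat n n (\<lambda>(i, j).
     if i = j then 4 else if i = j + 1 \<or> j = i + 1 then -1 else 0)"

definition cr_block :: "nat \<Rightarrow> real \<Rightarrow> real \<Rightarrow> nat \<Rightarrow> nat \<Rightarrow> real mat" where
  "cr_block n h \<theta> j k =
     (if j = 0 then
        (if k = 0 then \<theta> \<cdot>\<^sub>m 1\<^sub>m n else if k = 1 then (1 - \<theta>) \<cdot>\<^sub>m 1\<^sub>m n else 0\<^sub>m n n)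
      else if k + 1 = j then cr_B n h
      else if k = j then cr_G n h
      else if k = j + 1 then cr_B n h
      else 0\<^sub>m n n)"

text \<open>
  Row \<open>r\<close> of the full matrix is row \<open>r mod n\<close> of block row \<open>r div n\<close>, where the
  block rows are numbered \<open>0, \<dots>, n\<close>; likewise for columns.
\<close>

definition coco_russo_2d :: "nat \<Rightarrow> real \<Rightarrow> real \<Rightarrow> real mat" where
  "coco_russo_2d n h \<theta> = mat (n * (n + 1)) (n * (n + 1)) (\<lambda>(r, c).
     cr_block n h \<theta> (r div n) (c div n) $$ (r mod n, c mod n))"

end

theory Submission
  imports Defs "HOL-Real_Asymp.Real_Asymp"
begin

text \<open>
  In one dimension, the vector with entries \<open>sin ((n + 1 - j) t)\<close> satisfies all rows of the eigenvalue
  equation for \<open>2 - 2 cos t\<close> except row \<open>0\<close>, which becomes a scalar equation in \<open>t\<close>. Its residual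
  alternates in sign at the points \<open>k \<pi> / (n + 1)\<close>, so there are \<open>n - 1\<close> real eigenvalues
  \<open>2 - 2 cos t\<^sub>k\<close> with \<open>k \<pi> / (n + 1) < t\<^sub>k < (k + 1) \<pi> / (n + 1)\<close>. The two remaining
  eigenvalues, possibly not real, do not matter because the test functions are bounded, and the sum over
  the \<open>t\<^sub>k\<close> is a Riemann sum.

  In two dimensions, every block is a polynomial in the symmetric tridiagonal block \<open>h\<^sup>2 G\<close>, whose
  eigenvectors are the discrete sines. In this basis the matrix splits into \<open>n\<close> one-dimensional
  matrices with \<open>2\<close> replaced by \<open>4 - 2 cos (k \<pi> / (n + 1))\<close>. The estimate in one dimension is uniform
  in this parameter, so a second Riemann sum over \<open>k\<close> concludes.
\<close>

subsection \<open>Block matrices diagonalised blockwise\<close>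

text \<open>Reads a flattened index as a pair. \<open>char_poly_tensor\<close> uses it for both
  numberings of its index set, with blocks of side \<open>n\<close> and with blocks of side
  \<open>N\<close>.\<close>

lemma sum_div_mod:
  fixes g :: "nat \<Rightarrow> nat \<Rightarrow> 'a::comm_monoid_add"
  assumes "n > 0"
  shows "(\<Sum>r<n * N. g (r div n) (r mod n)) = (\<Sum>j<N. \<Sum>i<n. g j i)"
proof (induction N)
  case (Suc N)
  have "{..<n * Suc N} = {..<n * N} \<union> {n * N..<n * N + n}"
    by auto
  then have "(\<Sum>r<n * Suc N. g (r div n) (r mod n)) =
      (\<Sum>r<n * N. g (r div n) (r mod n)) + (\<Sum>r=n * N..<n * N + n. g (r div n) (r mod n))"
    by (simp add: sum.union_disjoint ivl_disj_int)
  also have "(\<Sum>r=n * N..<n * N + n. g (r div n) (r mod n)) = (\<Sum>i<n. g N i)"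
    using assms by (subst sum.atLeastLessThan_shift_0) (simp add: atLeast0LessThan)
  finally show ?case using Suc by simp
qed simp

lemma sum_tridiagonal:
  fixes f :: "nat \<Rightarrow> 'a::comm_ring_1"
  assumes "i < m"
  shows "(\<Sum>j<m. (if i = j then a else if i = j + 1 \<or> j = i + 1 then - 1 else 0) * f j) =
    a * f i - (if i = 0 then 0 else f (i - 1)) - (if Suc i < m then f (Suc i) else 0)"
proof -
  \<comment> \<open>For \<open>i = 0\<close> the truncated \<open>i - 1\<close> is 0 and would match
    \<open>j = 0\<close>, so the subdiagonal term carries its own guard.\<close>
  have "(\<Sum>j<m. (if i = j then a else if i = j + 1 \<or> j = i + 1 then - 1 else 0) * f j) =
    (\<Sum>j<m. (if j = i then a * f j else 0) - (if j = i - 1 then if i = 0 then 0 else f j else 0)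
        - (if j = Suc i then f j else 0))"
    by (rule sum.cong) auto
  also have "\<dots> = a * f i - (if i = 0 then 0 else f (i - 1)) - (if Suc i < m then f (Suc i) else 0)"
    using assms by (simp only: sum_subtractf) (auto simp: sum.delta)
  finally show ?thesis .
qed

lemma char_poly_four_block_diagonal:
  fixes A B :: "'a::idom mat"
  assumes A: "A \<in> carrier_mat n n" and B: "B \<in> carrier_mat m m"
  shows "char_poly (four_block_mat A (0\<^sub>m n m) (0\<^sub>m m n) B) = char_poly A * char_poly B"
proof -
  have "char_poly_matrix (four_block_mat A (0\<^sub>m n m) (0\<^sub>m m n) B) =
      four_block_mat (char_poly_matrix A) (0\<^sub>m n m) (0\<^sub>m m n) (char_poly_matrix B)"
    using A B by (intro eq_matI) (auto simp: char_poly_matrix_def)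
  then show ?thesis
    using A B unfolding char_poly_def
    by (simp add: det_four_block_mat_lower_left_zero[OF _ _ refl])
qed

text \<open>Induction on the number of blocks: the last one splits off as the lower right corner of
  a four-block matrix with zero off-diagonal blocks.\<close>

lemma char_poly_block_diagonal:
  fixes C :: "nat \<Rightarrow> nat \<Rightarrow> nat \<Rightarrow> 'a::idom"
  assumes "N > 0"
  shows "char_poly (mat (N * n) (N * n)
           (\<lambda>(r, c). if r div N = c div N then C (r div N) (r mod N) (c mod N) else 0)) =
    (\<Prod>k<n. char_poly (mat N N (\<lambda>(i, j). C k i j)))"
proof (induction n)
  case 0
  show ?case by (simp add: char_poly_def char_poly_matrix_def)
next
  case (Suc n)
  let ?D = "\<lambda>n. mat (N * n) (N * n)
    (\<lambda>(r, c). if r div N = c div N then C (r div N) (r mod N) (c mod N) else 0)"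
  have div: "r div N = n" "r mod N = r - N * n" if r: "\<not> r < N * n" "r < N * Suc n" for r
  proof -
    obtain s where s: "r = N * n + s" using r(1) le_Suc_ex[of "N * n" r] by auto
    with r have "s < N" by simp
    then show "r div N = n" "r mod N = r - N * n" using s by auto
  qed
  have divl: "r div N \<noteq> n" if "r < N * n" for r
    using that assms less_mult_imp_div_less[of r n N] by (simp add: mult.commute)
  have "?D (Suc n) = four_block_mat (?D n) (0\<^sub>m (N * n) N) (0\<^sub>m N (N * n)) (mat N N (\<lambda>(i, j). C n i j))"
    (is "_ = ?R")
  proof (rule eq_matI)
    fix i j assume "i < dim_row ?R" "j < dim_col ?R"
    then have ij: "i < N * Suc n" "j < N * Suc n" by auto
    show "?D (Suc n) $$ (i, j) = ?R $$ (i, j)"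
    proof (cases "i < N * n"; cases "j < N * n")
      assume "i < N * n" "\<not> j < N * n"
      then show ?thesis using ij div[of j] divl[of i] by simp
    next
      assume "\<not> i < N * n" "j < N * n"
      then show ?thesis using ij div[of i] divl[of j, THEN not_sym] by simp
    next
      assume "\<not> i < N * n" "\<not> j < N * n"
      then show ?thesis using ij div[of i] div[of j] by simp
    qed (use ij in simp)
  qed auto
  then have "char_poly (?D (Suc n)) = char_poly (?D n) * char_poly (mat N N (\<lambda>(i, j). C n i j))"
    by (simp add: char_poly_four_block_diagonal)
  then show ?case using Suc by simp
qed

text \<open>All blocks share the eigenvectors \<open>S _ k\<close>, with eigenvalue
  \<open>C k j j'\<close> on block \<open>(j, j')\<close>. Passing to this basis inside every block
  and grouping by mode \<open>k\<close> instead of by block is a similarity to a block diagonal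
  matrix with blocks \<open>C k\<close>.\<close>

lemma char_poly_tensor:
  fixes S :: "nat \<Rightarrow> nat \<Rightarrow> 'a::field" and b :: "nat \<Rightarrow> nat \<Rightarrow> nat \<Rightarrow> nat \<Rightarrow> 'a"
  assumes n: "n > 0" and N: "N > 0"
    and orth: "\<And>k l. k < n \<Longrightarrow> l < n \<Longrightarrow> (\<Sum>i<n. S i k * S i l) = (if k = l then w k else 0)"
    and w: "\<And>k. k < n \<Longrightarrow> w k \<noteq> 0"
    and eig: "\<And>j j' i k. j < N \<Longrightarrow> j' < N \<Longrightarrow> i < n \<Longrightarrow> k < n \<Longrightarrow>
      (\<Sum>l<n. b j j' i l * S l k) = C k j j' * S i k"
  shows "char_poly (mat (n * N) (n * N) (\<lambda>(r, c). b (r div n) (c div n) (r mod n) (c mod n))) =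
    (\<Prod>k<n. char_poly (mat N N (\<lambda>(j, j'). C k j j')))"
proof -
  define M where "M = mat (n * N) (n * N) (\<lambda>(r, c). b (r div n) (c div n) (r mod n) (c mod n))"
  \<comment> \<open>\<open>M\<close> and the rows of \<open>P\<close> number the pair (block \<open>j\<close>, inner \<open>i\<close>) as \<open>j * n + i\<close>; \<open>D\<close> and the columns
    of \<open>P\<close> number the pair (mode \<open>k\<close>, block \<open>j\<close>) as \<open>k * N + j\<close>, which makes \<open>D\<close> block diagonal.\<close>
  define D where "D = mat (n * N) (n * N)
    (\<lambda>(r, c). if r div N = c div N then C (r div N) (r mod N) (c mod N) else 0)"
  define P where "P = mat (n * N) (n * N)
    (\<lambda>(r, c). if r div n = c mod N then S (r mod n) (c div N) else 0)"
  \<comment> \<open>The transpose of \<open>P\<close> with row \<open>c\<close> divided by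
    \<open>w (c div N)\<close>. Orthogonality makes it a left inverse of the square matrix
    \<open>P\<close>, hence a two-sided one.\<close>
  define Q where "Q = mat (n * N) (n * N)
    (\<lambda>(c, r). if r div n = c mod N then S (r mod n) (c div N) / w (c div N) else 0)"
  have carrier [simp]: "M \<in> carrier_mat (n * N) (n * N)" "D \<in> carrier_mat (n * N) (n * N)"
    "P \<in> carrier_mat (n * N) (n * N)" "Q \<in> carrier_mat (n * N) (n * N)"
    by (simp_all add: M_def D_def P_def Q_def)
  have dm_n: "r div n < N" "r mod n < n" and dm_N: "r div N < n" "r mod N < N"
    if "r < n * N" for r
    using that n N by (auto simp: less_mult_imp_div_less mult.commute)
  have QP: "Q * P = 1\<^sub>m (n * N)"
  proof (rule eq_matI)
    fix c d assume "c < dim_row (1\<^sub>m (n * N) :: 'a mat)" "d < dim_col (1\<^sub>m (n * N) :: 'a mat)"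
    then have c: "c < n * N" and d: "d < n * N" by auto
    have "(Q * P) $$ (c, d) = (\<Sum>r<n * N.
        (if r div n = c mod N then S (r mod n) (c div N) / w (c div N) else 0) *
        (if r div n = d mod N then S (r mod n) (d div N) else 0))"
      using c d by (simp add: Q_def P_def scalar_prod_def atLeast0LessThan)
    also have "\<dots> = (\<Sum>j<N. \<Sum>i<n.
        (if j = c mod N then S i (c div N) / w (c div N) else 0) *
        (if j = d mod N then S i (d div N) else 0))"
      by (rule sum_div_mod[OF n])
    also have "\<dots> = (\<Sum>j<N. if j = c mod N then if c mod N = d mod N then
        (\<Sum>i<n. S i (c div N) * S i (d div N)) / w (c div N) else 0 else 0)"
      by (intro sum.cong refl) (auto simp: sum_divide_distrib)
    also have "\<dots> = (if c mod N = d mod N \<and> c div N = d div N then 1 else 0)"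
      using orth[OF dm_N(1)[OF c] dm_N(1)[OF d]] w[OF dm_N(1)[OF c]] dm_N(2)[OF c]
      by (auto simp: sum.delta)
    also have "\<dots> = 1\<^sub>m (n * N) $$ (c, d)"
      using c d by (auto, metis div_mult_mod_eq)
    finally show "(Q * P) $$ (c, d) = 1\<^sub>m (n * N) $$ (c, d)" .
  qed (auto simp: P_def Q_def)
  then have PQ: "P * Q = 1\<^sub>m (n * N)"
    by (intro mat_mult_left_right_inverse[of Q _ P]) auto
  \<comment> \<open>Either entry is an eigenvalue times an eigenvector component: on the left
    \<open>eig\<close> evaluates the sum over one block, on the right the sparsity of
    \<open>P\<close> and \<open>D\<close> leaves a single summand.\<close>
  have MP: "M * P = P * D"
  proof (rule eq_matI)
    fix r c assume "r < dim_row (P * D)" "c < dim_col (P * D)"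
    then have r: "r < n * N" and c: "c < n * N" by (auto simp: P_def D_def)
    have "(M * P) $$ (r, c) = (\<Sum>s<n * N. b (r div n) (s div n) (r mod n) (s mod n) *
        (if s div n = c mod N then S (s mod n) (c div N) else 0))"
      using r c by (simp add: M_def P_def scalar_prod_def atLeast0LessThan)
    also have "\<dots> = (\<Sum>j<N. \<Sum>i<n. b (r div n) j (r mod n) i *
        (if j = c mod N then S i (c div N) else 0))"
      by (rule sum_div_mod[OF n])
    also have "\<dots> = (\<Sum>j<N. if j = c mod N then
        (\<Sum>i<n. b (r div n) j (r mod n) i * S i (c div N)) else 0)"
      by (intro sum.cong refl) auto
    also have "\<dots> = C (c div N) (r div n) (c mod N) * S (r mod n) (c div N)"
      using dm_n[OF r] dm_N[OF c] by (simp add: sum.delta eig)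
    finally have lhs: "(M * P) $$ (r, c) = C (c div N) (r div n) (c mod N) * S (r mod n) (c div N)" .
    have "(P * D) $$ (r, c) = (\<Sum>s<N * n.
        (if r div n = s mod N then S (r mod n) (s div N) else 0) *
        (if s div N = c div N then C (s div N) (s mod N) (c mod N) else 0))"
      using r c by (simp add: P_def D_def scalar_prod_def atLeast0LessThan mult.commute[of N])
    also have "\<dots> = (\<Sum>k<n. \<Sum>j<N. (if r div n = j then S (r mod n) k else 0) *
        (if k = c div N then C k j (c mod N) else 0))"
      by (rule sum_div_mod[OF N])
    also have "\<dots> = (\<Sum>k<n. if k = c div N then
        S (r mod n) k * C k (r div n) (c mod N) else 0)"
      using dm_n[OF r] by (intro sum.cong refl) (auto simp: if_distrib[of "\<lambda>x. x * _"] cong: if_cong)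
    also have "\<dots> = S (r mod n) (c div N) * C (c div N) (r div n) (c mod N)"
      using dm_n[OF r] dm_N[OF c] by (simp add: sum.delta)
    finally show "(M * P) $$ (r, c) = (P * D) $$ (r, c)"
      using lhs by (simp add: mult.commute)
  qed (auto simp: M_def P_def D_def)
  have "M = M * (P * Q)"
    unfolding PQ by (simp add: right_mult_one_mat[OF carrier(1)])
  also have "\<dots> = P * D * Q"
    using assoc_mult_mat[OF carrier(1,3,4)] MP by simp
  finally have M_eq: "M = P * D * Q" .
  have "similar_mat M D"
    by (rule similar_matI[OF _ PQ QP M_eq]) simp
  then have "char_poly M = char_poly D"
    by (rule char_poly_similar)
  then show ?thesis
    using char_poly_block_diagonal[OF N, of n C] unfolding M_def D_def by (simp add: mult.commute)
qed

subsection \<open>Eigenvalues of one-dimensional ghost-point matrices\<close>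

text \<open>The common shape after scaling by h^2: \<open>\<kappa> = 2\<close> in one dimension, and
  one value of \<open>\<kappa>\<close> for each sine mode in two. Row 0 is the interpolation
  condition at the ghost point, with weights \<open>\<alpha>\<close> and
  \<open>\<beta>\<close>.\<close>

definition ghost_tridiagonal :: "nat \<Rightarrow> real \<Rightarrow> real \<Rightarrow> real \<Rightarrow> complex mat" where
  "ghost_tridiagonal n \<alpha> \<beta> \<kappa> = mat (n + 1) (n + 1) (\<lambda>(i, j). of_real
     (if i = 0 then if j = 0 then \<alpha> else if j = 1 then \<beta> else 0
      else if i = j then \<kappa> else if i = j + 1 \<or> j = i + 1 then - 1 else 0))"

lemma dim_ghost_tridiagonal [simp]:
  "dim_row (ghost_tridiagonal n \<alpha> \<beta> \<kappa>) = n + 1"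
  "dim_col (ghost_tridiagonal n \<alpha> \<beta> \<kappa>) = n + 1"
  by (simp_all add: ghost_tridiagonal_def)

text \<open>\<open>bc\<close> is row 0 of the eigenvalue equation for the sine vector, and
  \<open>sin t \<noteq> 0\<close> keeps this vector nonzero because its last entry is
  \<open>sin t\<close>.\<close>

lemma eigenvalue_ghost_tridiagonal:
  assumes n: "n \<ge> 1" and "sin t \<noteq> 0"
    and bc: "(\<kappa> - 2 * cos t - \<alpha>) * sin (real (n + 1) * t) = \<beta> * sin (real n * t)"
  shows "eigenvalue (ghost_tridiagonal n \<alpha> \<beta> \<kappa>) (of_real (\<kappa> - 2 * cos t))"
proof -
  define s where "s j = sin (real (n + 1 - j) * t)" for j
  define v where "v = vec (n + 1) (\<lambda>j. complex_of_real (s j))"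
  have s_rec: "s (i - 1) + (if Suc i < n + 1 then s (Suc i) else 0) = 2 * cos t * s i"
    if i: "0 < i" "i < n + 1" for i
  proof -
    have "s (Suc i) = sin (real (n + 1 - i) * t - t)"
      using i unfolding s_def by (simp add: of_nat_diff algebra_simps)
    moreover have "s (i - 1) = sin (real (n + 1 - i) * t + t)"
      using i unfolding s_def by (simp add: of_nat_diff algebra_simps)
    ultimately have "s (i - 1) + s (Suc i) = 2 * cos t * s i"
      by (simp add: s_def sin_add sin_diff)
    \<comment> \<open>Index \<open>n + 1\<close> belongs to \<open>sin 0\<close>, the eliminated
      boundary value, so the last row obeys the recurrence although its superdiagonal entry is
      missing.\<close>
    moreover have "s (Suc i) = 0" if "\<not> Suc i < n + 1"
      using that by (simp add: s_def)
    ultimately show ?thesis by auto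
  qed
  define e where "e i j = (if i = 0 then if j = 0 then \<alpha> else if j = 1 then \<beta> else 0
      else if i = j then \<kappa> else if i = j + 1 \<or> j = i + 1 then - 1 else 0)" for i j :: nat
  have row: "(\<Sum>j<n + 1. e i j * s j) = (\<kappa> - 2 * cos t) * s i" if "i < n + 1" for i
  proof (cases "i = 0")
    case True
    have "(\<Sum>j<n + 1. (if j = 0 then \<alpha> else if j = 1 then \<beta> else 0) * s j) =
        (\<Sum>j<n + 1. (if j = 0 then \<alpha> * s j else 0) + (if j = 1 then \<beta> * s j else 0))"
      by (rule sum.cong) auto
    also have "\<dots> = \<alpha> * s 0 + \<beta> * s 1"
      using n by (simp only: sum.distrib) (simp add: sum.delta)
    also have "\<dots> = (\<kappa> - 2 * cos t) * s 0"
      using bc by (simp add: s_def algebra_simps)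
    finally show ?thesis using True by (simp add: e_def)
  next
    case False
    have "\<kappa> * s i - s (i - 1) - (if Suc i < n + 1 then s (Suc i) else 0) = (\<kappa> - 2 * cos t) * s i"
      using s_rec[of i] that False by (simp add: algebra_simps)
    then show ?thesis
      using False sum_tridiagonal[OF that, of \<kappa> s] by (simp add: e_def)
  qed
  have A_eq: "ghost_tridiagonal n \<alpha> \<beta> \<kappa> = mat (n + 1) (n + 1) (\<lambda>(i, j). of_real (e i j))"
    by (simp add: ghost_tridiagonal_def e_def)
  have "ghost_tridiagonal n \<alpha> \<beta> \<kappa> *\<^sub>v v = of_real (\<kappa> - 2 * cos t) \<cdot>\<^sub>v v"
  proof (rule eq_vecI)
    fix i assume "i < dim_vec (of_real (\<kappa> - 2 * cos t) \<cdot>\<^sub>v v)"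
    then have i: "i < n + 1" by (simp add: v_def)
    then have "(ghost_tridiagonal n \<alpha> \<beta> \<kappa> *\<^sub>v v) $ i =
        (\<Sum>j<n + 1. complex_of_real (e i j * s j))"
      by (simp add: A_eq v_def scalar_prod_def atLeast0LessThan del: sum.lessThan_Suc)
    also have "\<dots> = of_real ((\<kappa> - 2 * cos t) * s i)"
      by (simp only: of_real_sum[symmetric] row[OF i])
    finally show "(ghost_tridiagonal n \<alpha> \<beta> \<kappa> *\<^sub>v v) $ i = (of_real (\<kappa> - 2 * cos t) \<cdot>\<^sub>v v) $ i"
      using i by (simp add: v_def)
  qed (simp add: v_def)
  moreover have "v $ n \<noteq> 0\<^sub>v (n + 1) $ n"
    using assms(2) by (simp add: v_def s_def)
  then have "v \<noteq> 0\<^sub>v (n + 1)" by metis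
  ultimately show ?thesis
    unfolding eigenvalue_def eigenvector_def
    by (intro exI[of _ v]) (auto simp: v_def)
qed

text \<open>The strict bounds matter: roots found in adjacent intervals cannot coincide at a shared
  endpoint.\<close>

lemma real_root_of_sign_change:
  fixes g :: "real \<Rightarrow> real"
  assumes "a \<le> b" "continuous_on {a..b} g" "g a * g b < 0"
  obtains t where "a < t" "t < b" "g t = 0"
proof -
  have "\<exists>t\<ge>a. t \<le> b \<and> g t = 0"
  proof (cases "g a < 0")
    case True
    with assms(3) have "g b > 0" by (simp add: mult_less_0_iff)
    with True IVT'[of g a 0 b] assms show ?thesis by auto
  next
    case False
    with assms(3) have "g a > 0" "g b < 0" by (auto simp: mult_less_0_iff)
    with IVT2'[of g b 0 a] assms show ?thesis by auto
  qed
  then obtain t where t: "a \<le> t" "t \<le> b" "g t = 0" by blast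
  moreover have "t \<noteq> a" "t \<noteq> b" using t(3) assms(3) by auto
  ultimately show ?thesis using that[of t] by simp
qed

text \<open>At the points \<open>j * pi / (n + 1)\<close> the residual loses its term in
  \<open>\<alpha>\<close> and \<open>\<kappa>\<close>, so its sign pattern depends on
  \<open>\<beta>\<close> alone. The intervals are therefore the same for all parameters, which gives
  uniformity over the modes in two dimensions.\<close>

lemma eigvals_ghost_tridiagonal:
  assumes n: "n \<ge> 1" and \<beta>: "\<beta> \<noteq> 0"
  obtains t R where
    "\<And>j. j \<in> {1..<n} \<Longrightarrow> t j \<in> {real j * pi / real (n + 1) .. real (j + 1) * pi / real (n + 1)}"
    "eigvals_mset (ghost_tridiagonal n \<alpha> \<beta> \<kappa>) =
       image_mset (\<lambda>j. of_real (\<kappa> - 2 * cos (t j))) (mset_set {1..<n}) + R"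
    "size R = 2"
proof -
  define A where "A = ghost_tridiagonal n \<alpha> \<beta> \<kappa>"
  define u where "u j = real j * pi / real (n + 1)" for j
  define g where "g t = (\<kappa> - 2 * cos t - \<alpha>) * sin (real (n + 1) * t) - \<beta> * sin (real n * t)" for t
  have u_mono: "u i \<le> u j" if "i \<le> j" for i j
    using that by (simp add: u_def divide_right_mono mult_right_mono)
  have sin_u: "sin (u j) > 0" if "1 \<le> j" "j \<le> n" for j
  proof (rule sin_gt_zero)
    have "real j * pi < real (n + 1) * pi"
      using that by (intro mult_strict_right_mono) auto
    then show "u j < pi" by (simp add: u_def field_simps)
  qed (use that in \<open>simp add: u_def\<close>)
  have g_u: "g (u j) = \<beta> * (- 1) ^ j * sin (u j)" for j
  proof -
    have eq: "real (n + 1) * u j = real j * pi"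
      by (simp add: u_def)
    then have "real n * u j = real j * pi - u j"
      by (simp add: algebra_simps)
    then have "sin (real n * u j) = - ((- 1) ^ j * sin (u j))"
      by (simp add: sin_diff)
    then show ?thesis
      using eq by (simp add: g_def)
  qed
  have "\<exists>t. u j < t \<and> t < u (j + 1) \<and> g t = 0" if j: "j \<in> {1..<n}" for j
  proof -
    \<comment> \<open>Consecutive powers of -1 have opposite signs, and both sines are positive
      because \<open>1 \<le> j\<close> and \<open>j + 1 \<le> n\<close>; this is where the range
      \<open>{1..<n}\<close> comes from.\<close>
    have "g (u j) * g (u (j + 1)) = - (\<beta>\<^sup>2 * (sin (u j) * sin (u (j + 1))))"
      by (simp add: g_u power2_eq_square algebra_simps flip: power_mult_distrib)
    also have "\<dots> < 0"
      using sin_u[of j] sin_u[of "j + 1"] j \<beta> by simp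
    finally have "g (u j) * g (u (j + 1)) < 0" .
    moreover have "continuous_on {u j..u (j + 1)} g"
      unfolding g_def by (intro continuous_intros)
    ultimately show ?thesis
      using real_root_of_sign_change[of "u j" "u (j + 1)" g] u_mono[of j "j + 1"] by auto
  qed
  then obtain t where t: "u j < t j" "t j < u (j + 1)" "g (t j) = 0" if "j \<in> {1..<n}" for j
    by metis
  have t_range: "0 < t j" "t j < pi" if "j \<in> {1..<n}" for j
  proof -
    have "0 \<le> u j" "u (j + 1) \<le> pi" using that by (auto simp: u_def field_simps)
    then show "0 < t j" "t j < pi" using t[OF that] by auto
  qed
  define \<mu> where "\<mu> j = complex_of_real (\<kappa> - 2 * cos (t j))" for j
  \<comment> \<open>The \<open>t j\<close> lie in disjoint open intervals inside
    \<open>(0, pi)\<close>, where the cosine is strictly decreasing.\<close>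
  have "\<mu> i \<noteq> \<mu> j" if "i \<in> {1..<n}" "j \<in> {1..<n}" "i < j" for i j
  proof -
    have "t i < t j"
      using t(2)[OF that(1)] t(1)[OF that(2)] u_mono[of "i + 1" j] that(3) by simp
    then have "cos (t j) < cos (t i)"
      using t_range[OF that(1)] t_range[OF that(2)] by (intro cos_monotone_0_pi) auto
    then show ?thesis by (simp add: \<mu>_def)
  qed
  then have inj: "inj_on \<mu> {1..<n}"
    by (metis inj_onI nat_neq_iff)
  have carrier: "A \<in> carrier_mat (n + 1) (n + 1)"
    unfolding A_def ghost_tridiagonal_def by simp
  have deg: "degree (char_poly A) = n + 1" "char_poly A \<noteq> 0"
    using degree_monic_char_poly[OF carrier] by auto
  have "\<mu> j \<in># proots (char_poly A)" if j: "j \<in> {1..<n}" for j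
  proof -
    have "sin (t j) \<noteq> 0"
      using sin_gt_zero[OF t_range[OF j]] by simp
    then have "eigenvalue A (\<mu> j)"
      using t(3)[OF j] unfolding A_def \<mu>_def g_def
      by (intro eigenvalue_ghost_tridiagonal n) auto
    then show ?thesis
      using deg(2) by (simp add: eigenvalue_root_char_poly[OF carrier])
  qed
  \<comment> \<open>Distinct roots, counted once each, fit inside the roots counted with
    multiplicity. The rest is \<open>R\<close>, of size
    \<open>(n + 1) - (n - 1) = 2\<close>.\<close>
  then have "mset_set (\<mu> ` {1..<n}) \<subseteq># mset_set (set_mset (proots (char_poly A)))"
    by (intro subset_imp_msubset_mset_set) auto
  also have "\<dots> \<subseteq># proots (char_poly A)"
    by (rule mset_set_set_mset_msubset)
  finally have sub: "image_mset \<mu> (mset_set {1..<n}) \<subseteq># eigvals_mset A"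
    unfolding eigvals_mset_def image_mset_mset_set[OF inj] .
  then obtain R where R: "eigvals_mset A = image_mset \<mu> (mset_set {1..<n}) + R"
    by (metis subset_mset.add_diff_inverse)
  have "size (eigvals_mset A) = n + 1"
    using deg by (simp add: eigvals_mset_def size_proots_complex)
  then have "size R = 2"
    using n unfolding R by simp
  with R show ?thesis
    using that[of t R] t unfolding A_def \<mu>_def u_def by (auto intro: less_imp_le)
qed

subsection \<open>Averages of test functions over the eigenvalues\<close>

text \<open>The error is bounded by the oscillation at mesh scale, for arbitrary sample points and
  without a limit, so that one \<open>\<epsilon>\<close> can serve a whole family of functions
  \<open>g\<close>.\<close>

lemma riemann_sum_error:
  fixes g :: "real \<Rightarrow> complex"
  assumes cont: "continuous_on {0..pi} g" and m: "m > 0"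
    and osc: "\<And>s t. s \<in> {0..pi} \<Longrightarrow> t \<in> {0..pi} \<Longrightarrow> \<bar>s - t\<bar> \<le> pi / real m \<Longrightarrow> norm (g s - g t) \<le> \<epsilon>"
    and t: "\<And>j. j < m \<Longrightarrow> t j \<in> {real j * pi / real m .. real (j + 1) * pi / real m}"
  shows "norm ((\<Sum>j<m. g (t j)) / of_nat m - integral {0..pi} g / of_real pi) \<le> \<epsilon>"
proof -
  define u where "u j = real j * pi / real m" for j
  have u: "u 0 = 0" "u m = pi" "u (Suc j) = u j + pi / real m" for j
    using m by (auto simp: u_def field_simps)
  have u_mono: "u i \<le> u j" if "i \<le> j" for i j
    using that by (simp add: u_def divide_right_mono mult_right_mono)
  have step: "norm (integral {u j..u (Suc j)} g - of_real (pi / real m) * g (t j)) \<le> \<epsilon> * (pi / real m)"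
    if "j < m" for j
  proof -
    have sub: "{u j..u (Suc j)} \<subseteq> {0..pi}"
      using u_mono[of 0 j] u_mono[of "Suc j" m] that by (auto simp: u)
    have tj: "t j \<in> {u j..u (Suc j)}"
      using t[OF that] by (simp add: u_def)
    have cont': "continuous_on {u j..u (Suc j)} g"
      using continuous_on_subset[OF cont sub] .
    have "integral {u j..u (Suc j)} g - of_real (pi / real m) * g (t j) =
        integral {u j..u (Suc j)} (\<lambda>s. g s - g (t j))"
      using u_mono[of j "Suc j"] u(3)[of j]
      by (subst integral_diff[OF integrable_continuous_real[OF cont']]) (auto simp: scaleR_conv_of_real)
    also have "norm \<dots> \<le> \<epsilon> * (u (Suc j) - u j)"
    proof (rule integral_bound)
      fix s assume "s \<in> {u j..u (Suc j)}"
      then show "norm (g s - g (t j)) \<le> \<epsilon>"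
        using tj sub u(3)[of j] by (intro osc) auto
    qed (use u_mono[of j "Suc j"] in \<open>auto intro!: continuous_intros cont'\<close>)
    finally show ?thesis by (simp add: u)
  qed
  \<comment> \<open>The cell errors from \<open>step\<close> accumulate by induction over the first
    \<open>k\<close> cells.\<close>
  have "norm (integral {0..u k} g - (\<Sum>j<k. of_real (pi / real m) * g (t j))) \<le> real k * (\<epsilon> * (pi / real m))"
    if "k \<le> m" for k
    using that
  proof (induction k)
    case 0
    then show ?case by (simp add: u)
  next
    case (Suc k)
    have "g integrable_on {0..u (Suc k)}"
      using continuous_on_subset[OF cont] u_mono[of "Suc k" m] Suc.prems
      by (intro integrable_continuous_real) (auto simp: u)
    then have "integral {0..u (Suc k)} g = integral {0..u k} g + integral {u k..u (Suc k)} g"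
      using Henstock_Kurzweil_Integration.integral_combine[where a = 0 and c = "u k" and b = "u (Suc k)" and f = g] u_mono[of 0 k] u_mono[of k "Suc k"]
      by (simp add: u(1))
    then have "integral {0..u (Suc k)} g - (\<Sum>j<Suc k. of_real (pi / real m) * g (t j)) =
        (integral {0..u k} g - (\<Sum>j<k. of_real (pi / real m) * g (t j))) +
        (integral {u k..u (Suc k)} g - of_real (pi / real m) * g (t k))"
      by simp
    also have "norm \<dots> \<le> real k * (\<epsilon> * (pi / real m)) + \<epsilon> * (pi / real m)"
      using Suc step[of k] by (intro norm_triangle_mono) auto
    finally show ?case by (simp add: algebra_simps add_divide_distrib)
  qed
  from this[of m] have "norm (integral {0..pi} g - (\<Sum>j<m. of_real (pi / real m) * g (t j))) \<le> \<epsilon> * pi"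
    using m by (simp add: u)
  also have "integral {0..pi} g - (\<Sum>j<m. of_real (pi / real m) * g (t j)) =
      - of_real pi * ((\<Sum>j<m. g (t j)) / of_nat m - integral {0..pi} g / of_real pi)"
    using m by (simp only: sum_distrib_left[symmetric]) (simp add: field_simps)
  finally show ?thesis
    by (simp add: norm_mult)
qed

lemma norm_sum_mset_le:
  fixes F :: "'a \<Rightarrow> 'b::real_normed_vector"
  assumes "\<And>z. norm (F z) \<le> B"
  shows "norm (\<Sum>z\<in>#R. F z) \<le> real (size R) * B"
proof (induction R)
  case (add x R)
  then show ?case
    using norm_triangle_mono[OF assms[of x] add] by (simp add: algebra_simps)
qed simp

text \<open>Two eigenvalues have unknown location and two of the \<open>n + 1\<close> cells have no
  root assigned. Repairing both changes the sum by at most four values of \<open>F\<close>, whence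
  \<open>4 * B\<close>. The bound involves none of \<open>\<alpha>\<close>, \<open>\<beta>\<close>,
  \<open>\<kappa>\<close>.\<close>

lemma ghost_tridiagonal_average_error:
  fixes F :: "complex \<Rightarrow> complex"
  assumes n: "n \<ge> 1" and \<beta>: "\<beta> \<noteq> 0" and B: "\<And>z. norm (F z) \<le> B"
    and cont: "continuous_on {0..pi} (\<lambda>t. F (of_real (\<kappa> - 2 * cos t)))"
    and osc: "\<And>s t. s \<in> {0..pi} \<Longrightarrow> t \<in> {0..pi} \<Longrightarrow> \<bar>s - t\<bar> \<le> pi / real (n + 1) \<Longrightarrow>
      norm (F (of_real (\<kappa> - 2 * cos s)) - F (of_real (\<kappa> - 2 * cos t))) \<le> \<epsilon>"
  shows "norm ((\<Sum>z\<in>#eigvals_mset (ghost_tridiagonal n \<alpha> \<beta> \<kappa>). F z) / of_nat (n + 1) -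
    integral {0..pi} (\<lambda>t. F (of_real (\<kappa> - 2 * cos t))) / of_real pi) \<le> \<epsilon> + 4 * B / real (n + 1)"
proof -
  obtain t R where t: "\<And>j. j \<in> {1..<n} \<Longrightarrow> t j \<in> {real j * pi / real (n + 1) .. real (j + 1) * pi / real (n + 1)}"
    and eig: "eigvals_mset (ghost_tridiagonal n \<alpha> \<beta> \<kappa>) =
       image_mset (\<lambda>j. of_real (\<kappa> - 2 * cos (t j))) (mset_set {1..<n}) + R"
    and R: "size R = 2"
    using eigvals_ghost_tridiagonal[OF n \<beta>] by metis
  define G where "G s = F (of_real (\<kappa> - 2 * cos s))" for s
  \<comment> \<open>Cells 0 and \<open>n\<close> receive their left endpoints, which completes a
    Riemann sum; \<open>E\<close> records the correction.\<close>
  define t' where "t' j = (if j \<in> {1..<n} then t j else real j * pi / real (n + 1))" for j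
  have t': "t' j \<in> {real j * pi / real (n + 1) .. real (j + 1) * pi / real (n + 1)}" for j
    using t[of j] by (auto simp: t'_def divide_right_mono mult_right_mono)
  define E where "E = (\<Sum>z\<in>#R. F z) - G (t' 0) - G (t' n)"
  have "{..<n + 1} = insert 0 (insert n {1..<n})" using n by auto
  then have "(\<Sum>j<n + 1. G (t' j)) = G (t' 0) + (G (t' n) + (\<Sum>j\<in>{1..<n}. G (t j)))"
    using n by (simp add: t'_def)
  moreover have "(\<Sum>z\<in>#eigvals_mset (ghost_tridiagonal n \<alpha> \<beta> \<kappa>). F z) =
      (\<Sum>j\<in>{1..<n}. G (t j)) + (\<Sum>z\<in>#R. F z)"
    by (simp add: eig G_def image_mset.compositionality comp_def sum_unfold_sum_mset)
  ultimately have sum_eq: "(\<Sum>z\<in>#eigvals_mset (ghost_tridiagonal n \<alpha> \<beta> \<kappa>). F z) =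
      (\<Sum>j<n + 1. G (t' j)) + E"
    by (simp add: E_def)
  have "(\<Sum>z\<in>#eigvals_mset (ghost_tridiagonal n \<alpha> \<beta> \<kappa>). F z) / of_nat (n + 1) -
      integral {0..pi} G / of_real pi =
      ((\<Sum>j<n + 1. G (t' j)) / of_nat (n + 1) - integral {0..pi} G / of_real pi) + E / of_nat (n + 1)"
    unfolding sum_eq add_divide_distrib by (rule diff_add_eq[symmetric])
  also have "norm \<dots> \<le> \<epsilon> + 4 * B / real (n + 1)"
  proof (rule norm_triangle_mono)
    show "norm ((\<Sum>j<n + 1. G (t' j)) / of_nat (n + 1) - integral {0..pi} G / of_real pi) \<le> \<epsilon>"
      using cont osc t' unfolding G_def by (intro riemann_sum_error) auto
    have "norm E \<le> 2 * B + B + B"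
      unfolding E_def G_def using norm_sum_mset_le[of F B R] R B
      by (intro order_trans[OF norm_triangle_ineq4] add_mono) auto
    then show "norm (E / of_nat (n + 1)) \<le> 4 * B / real (n + 1)"
      by (simp add: norm_divide divide_right_mono del: of_nat_Suc of_nat_add)
  qed
  finally show ?thesis unfolding G_def .
qed

subsection \<open>The Coco--Russo matrices\<close>

text \<open>The scaling cancels \<open>1 / h^2\<close> in rows 1 to \<open>n\<close> but leaves a
  factor h^2 on the interpolation row.\<close>

lemma coco_russo_1d_eq_ghost_tridiagonal:
  assumes "h \<noteq> 0"
  shows "map_mat complex_of_real (h\<^sup>2 \<cdot>\<^sub>m coco_russo_1d n h \<theta>) =
    ghost_tridiagonal n (h\<^sup>2 * \<theta>) (h\<^sup>2 * (1 - \<theta>)) 2"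
  using assms by (intro eq_matI) (auto simp: coco_russo_1d_def ghost_tridiagonal_def)

text \<open>The discrete sine vanishes at both positions just outside the index range, so the
  addition formulas cover the end rows too.\<close>

lemma sum_diagonal_tridiagonal_sin:
  fixes n k :: nat
  defines "v \<equiv> \<lambda>i. sin (real ((i + 1) * (k + 1)) * pi / real (n + 1))"
  assumes "i < n"
  shows "(\<Sum>l<n. (if i = l then 4 else if i = l + 1 \<or> l = i + 1 then - 1 else 0) * v l) =
    (4 - 2 * cos (real (k + 1) * pi / real (n + 1))) * v i"
proof -
  define u where "u = real (k + 1) * pi / real (n + 1)"
  have v: "v i = sin (real (i + 1) * u)" for i
    by (simp add: v_def u_def algebra_simps)
  have "(if i = 0 then 0 else v (i - 1)) = sin (real i * u)"
    by (simp add: v)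
  moreover have "(if Suc i < n then v (Suc i) else 0) = sin (real (i + 2) * u)"
  proof (cases "Suc i < n")
    case False
    then have "i + 2 = n + 1" using assms(2) by simp
    then have "real (i + 2) * u = real (k + 1) * pi"
      by (simp add: u_def)
    then show ?thesis using False by (simp only: sin_npi) simp
  qed (simp add: v algebra_simps)
  moreover have "sin (real i * u) + sin (real (i + 2) * u) = 2 * cos u * v i"
  proof -
    have "real i * u = real (i + 1) * u - u" "real (i + 2) * u = real (i + 1) * u + u"
      by (simp_all add: algebra_simps)
    then show ?thesis by (simp only: v sin_add sin_diff) simp
  qed
  ultimately show ?thesis
    using sum_tridiagonal[OF assms(2), of 4 v] unfolding u_def[symmetric] by (simp add: algebra_simps)
qed

text \<open>Evaluates the bilinear form of \<open>K\<close> at \<open>x\<close> and \<open>y\<close>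
  from either side. This makes the discrete sines orthogonal without summing trigonometric
  products.\<close>

lemma orthogonal_eigenvectors:
  fixes K :: "nat \<Rightarrow> nat \<Rightarrow> real"
  assumes sym: "\<And>i j. K i j = K j i" and "a \<noteq> b"
    and x: "\<And>i. i < n \<Longrightarrow> (\<Sum>l<n. K i l * x l) = a * x i"
    and y: "\<And>i. i < n \<Longrightarrow> (\<Sum>l<n. K i l * y l) = b * y i"
  shows "(\<Sum>i<n. x i * y i) = 0"
proof -
  have "a * (\<Sum>i<n. x i * y i) = (\<Sum>i<n. \<Sum>l<n. K i l * x l * y i)"
    by (simp add: sum_distrib_left sum_distrib_right x[symmetric] mult.assoc[symmetric])
  also have "\<dots> = (\<Sum>l<n. \<Sum>i<n. K i l * x l * y i)"
    by (rule sum.swap)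
  also have "\<dots> = (\<Sum>l<n. \<Sum>i<n. x l * (K l i * y i))"
    by (intro sum.cong refl) (simp add: sym mult_ac)
  also have "\<dots> = (\<Sum>l<n. x l * (b * y l))"
    by (simp add: sum_distrib_left[symmetric] y)
  also have "\<dots> = b * (\<Sum>i<n. x i * y i)"
    by (simp add: sum_distrib_left mult_ac)
  finally show ?thesis using \<open>a \<noteq> b\<close> by simp
qed

lemma eigvals_coco_russo_2d:
  assumes n: "n \<ge> 1" and h: "h \<noteq> 0"
  shows "eigvals_mset (map_mat complex_of_real (h\<^sup>2 \<cdot>\<^sub>m coco_russo_2d n h \<theta>)) =
    (\<Sum>k<n. eigvals_mset (ghost_tridiagonal n (h\<^sup>2 * \<theta>) (h\<^sup>2 * (1 - \<theta>))
      (4 - 2 * cos (real (k + 1) * pi / real (n + 1)))))"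
proof -
  define M where "M = map_mat complex_of_real (h\<^sup>2 \<cdot>\<^sub>m coco_russo_2d n h \<theta>)"
  define \<kappa> where "\<kappa> k = 4 - 2 * cos (real (k + 1) * pi / real (n + 1))" for k
  define v where "v i k = sin (real ((i + 1) * (k + 1)) * pi / real (n + 1))" for i k
  define K where "K i l = (if i = l then 4 else if i = l + 1 \<or> l = i + 1 then - 1 else 0 :: real)" for i l :: nat
  \<comment> \<open>\<open>c k i j\<close> is the eigenvalue of the scaled block
    \<open>(i, j)\<close> on the sine vector of mode \<open>k\<close>.\<close>
  define c where "c k i j = (if i = 0 then if j = 0 then h\<^sup>2 * \<theta> else if j = 1 then h\<^sup>2 * (1 - \<theta>) else 0
      else if i = j then \<kappa> k else if i = j + 1 \<or> j = i + 1 then - 1 else 0)" for k i j :: nat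
  have K_eig: "(\<Sum>l<n. K i l * v l k) = \<kappa> k * v i k" if "i < n" for i k
    unfolding K_def v_def \<kappa>_def using sum_diagonal_tridiagonal_sin[OF that] .
  have orth: "(\<Sum>i<n. v i k * v i l) = 0" if "k < n" "l < n" "k \<noteq> l" for k l
  proof (rule orthogonal_eigenvectors[of K])
    have range: "0 \<le> real (m + 1) * pi / real (n + 1)" "real (m + 1) * pi / real (n + 1) \<le> pi" if "m < n" for m
      using that by (auto simp: field_simps)
    show "\<kappa> k \<noteq> \<kappa> l"
    proof
      assume "\<kappa> k = \<kappa> l"
      then have "cos (real (k + 1) * pi / real (n + 1)) = cos (real (l + 1) * pi / real (n + 1))"
        by (simp add: \<kappa>_def)
      then have "real (k + 1) * pi / real (n + 1) = real (l + 1) * pi / real (n + 1)"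
        by (rule cos_inj_pi[OF range[OF that(1)] range[OF that(2)]])
      then show False using that(3) by simp
    qed
  qed (use K_eig in \<open>auto simp: K_def\<close>)
  have norm_pos: "(\<Sum>i<n. v i k * v i k) > 0" if "k < n" for k
  proof (rule sum_pos2[of _ 0])
    have "real (k + 1) * pi < real (n + 1) * pi"
      using that by (intro mult_strict_right_mono) auto
    then have "v 0 k > 0"
      unfolding v_def by (intro sin_gt_zero) (auto simp: field_simps intro: add_pos_nonneg)
    then show "0 < v 0 k * v 0 k" by simp
  qed (use n in auto)
  define b where "b j j' i l = complex_of_real (h\<^sup>2 * cr_block n h \<theta> j j' $$ (i, l))" for j j' i l
  have "M = mat (n * (n + 1)) (n * (n + 1)) (\<lambda>(r, c). b (r div n) (c div n) (r mod n) (c mod n))"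
    unfolding M_def b_def coco_russo_2d_def by (intro eq_matI) auto
  also have "char_poly \<dots> = (\<Prod>k<n. char_poly (mat (n + 1) (n + 1) (\<lambda>(i, j). of_real (c k i j))))"
  proof (rule char_poly_tensor[where S = "\<lambda>i k. of_real (v i k)" and w = "\<lambda>k. of_real (\<Sum>i<n. v i k * v i k)"])
    show "(\<Sum>i<n. complex_of_real (v i k) * complex_of_real (v i l)) =
        (if k = l then complex_of_real (\<Sum>i<n. v i k * v i k) else 0)" if "k < n" "l < n" for k l
      using orth[OF that] by (auto simp flip: of_real_mult of_real_sum)
    show "complex_of_real (\<Sum>i<n. v i k * v i k) \<noteq> 0" if "k < n" for k
      using norm_pos[OF that] by (simp only: of_real_eq_0_iff)
    show "(\<Sum>l<n. b j j' i l * complex_of_real (v l k)) = complex_of_real (c k j j') * complex_of_real (v i k)"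
      if "j < n + 1" "j' < n + 1" "i < n" "k < n" for j j' i k
    \<comment> \<open>The diagonal blocks below block row 0 are h^2 \<open>G\<close>, with the sines
      as eigenvectors; every other block is a scalar multiple of the identity.\<close>
    proof (cases "j = j' \<and> j \<noteq> 0")
      case True
      then have "b j j' i l = of_real (K i l)" if "l < n" for l
        using that \<open>i < n\<close> h by (auto simp: b_def cr_block_def cr_G_def K_def)
      then have "(\<Sum>l<n. b j j' i l * of_real (v l k)) = of_real (\<Sum>l<n. K i l * v l k)"
        by simp
      then show ?thesis
        using K_eig[OF \<open>i < n\<close>] True by (simp add: c_def)
    next
      case False
      then have "b j j' i l = (if l = i then of_real (c k j j') else 0)" if "l < n" for l
        using that \<open>i < n\<close> h by (auto simp: b_def cr_block_def cr_B_def c_def)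
      then have "(\<Sum>l<n. b j j' i l * of_real (v l k)) =
          (\<Sum>l<n. if l = i then of_real (c k j j') * of_real (v l k) else 0)"
        by (intro sum.cong) auto
      then show ?thesis
        using \<open>i < n\<close> by (simp add: sum.delta)
    qed
  qed (use n in auto)
  also have "\<dots> = (\<Prod>k<n. char_poly (ghost_tridiagonal n (h\<^sup>2 * \<theta>) (h\<^sup>2 * (1 - \<theta>)) (\<kappa> k)))"
    by (simp only: ghost_tridiagonal_def c_def)
  finally have "char_poly M = (\<Prod>k<n. char_poly (ghost_tridiagonal n (h\<^sup>2 * \<theta>) (h\<^sup>2 * (1 - \<theta>)) (\<kappa> k)))" .
  \<comment> \<open>Root multisets add up over a product of nonzero polynomials.\<close>
  moreover have "char_poly (ghost_tridiagonal n \<alpha> \<beta> x) \<noteq> 0" for \<alpha> \<beta> x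
    using degree_monic_char_poly[of "ghost_tridiagonal n \<alpha> \<beta> x" "n + 1"]
    by (auto simp: ghost_tridiagonal_def)
  ultimately show ?thesis
    unfolding eigvals_mset_def M_def[symmetric] \<kappa>_def[symmetric] by (simp add: proots_prod)
qed

subsection \<open>Limits of the averages\<close>

text \<open>This bound limits the effect of the eigenvalues whose location is unknown.\<close>

lemma C_c_bounded:
  assumes "F \<in> C_c"
  obtains B where "\<And>z. norm (F z) \<le> B"
proof -
  let ?S = "closure {z. F z \<noteq> 0}"
  have "continuous_on ?S F" "compact ?S"
    using assms continuous_on_subset[of UNIV F ?S] by (auto simp: C_c_def)
  then have "bounded (F ` ?S)"
    by (intro compact_imp_bounded compact_continuous_image)
  then obtain B where B: "B > 0" "\<And>z. z \<in> ?S \<Longrightarrow> norm (F z) \<le> B"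
    by (auto simp: bounded_pos)
  have "norm (F z) \<le> B" for z
    using B closure_subset[of "{z. F z \<noteq> 0}"] by (cases "F z = 0") auto
  then show ?thesis using that by blast
qed

text \<open>Here \<open>\<epsilon>\<close> stands for uniform continuity and
  \<open>C / (n + 1)\<close> for boundedly many exceptional terms; \<open>C\<close> is fixed before
  \<open>\<epsilon>\<close>.\<close>

lemma tendsto_of_error_bound:
  fixes a :: "nat \<Rightarrow> 'a::real_normed_vector"
  assumes "\<And>\<epsilon>. \<epsilon> > 0 \<Longrightarrow> \<forall>\<^sub>F n in sequentially. norm (a n - L) \<le> \<epsilon> + C / real (n + 1)"
  shows "a \<longlonglongrightarrow> L"
proof (rule tendstoI)
  fix e :: real assume e: "e > 0"
  have "(\<lambda>n. C / real (n + 1)) \<longlonglongrightarrow> 0"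
    by (intro tendsto_divide_0[OF tendsto_const] filterlim_at_top_imp_at_infinity)
       (intro filterlim_compose[OF filterlim_real_sequentially] filterlim_add_const_nat_at_top)
  then have "\<forall>\<^sub>F n in sequentially. C / real (n + 1) < e / 2"
    using e by (intro order_tendstoD) auto
  moreover have "\<forall>\<^sub>F n in sequentially. norm (a n - L) \<le> e / 2 + C / real (n + 1)"
    using assms[of "e / 2"] e by simp
  ultimately show "\<forall>\<^sub>F n in sequentially. dist (a n) L < e"
    by eventually_elim (unfold dist_norm, linarith)
qed

text \<open>The angles of the eigenvalues lie in \<open>(0, pi)\<close>, whereas the symbols have
  symmetric domains; evenness of the cosine folds the latter.\<close>

lemma integral_even:
  fixes g :: "real \<Rightarrow> complex"
  assumes "continuous_on {-a..a} g" "a \<ge> 0" "\<And>x. g (- x) = g x"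
  shows "integral {-a..a} g = 2 * integral {0..a} g"
proof -
  have "integral {-a..a} g = integral {-a..0} g + integral {0..a} g"
    using assms(1,2) by (intro Henstock_Kurzweil_Integration.integral_combine[symmetric] integrable_continuous_real) auto
  also have "integral {-a..0} g = integral {0..a} g"
    using Henstock_Kurzweil_Integration.integral_reflect_real[of a 0 g] assms(3) by simp
  finally show ?thesis by simp
qed

lemma lebesgue_integral_cbox_continuous:
  fixes g :: "'a::euclidean_space \<Rightarrow> 'b::euclidean_space"
  assumes "continuous_on (cbox a b) g"
  shows "(LINT x|lebesgue_on (cbox a b). g x) = integral (cbox a b) g"
  using assms by (intro lebesgue_integral_eq_integral absolutely_integrable_imp_integrable
      absolutely_integrable_continuous) auto

text \<open>The two assumptions make \<open>\<beta> = h^2 * (1 - \<theta>)\<close> nonzero, as the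
  location of the roots requires. They start at \<open>n = 1\<close>, since a limit ignores finitely
  many indices.\<close>

lemma spectral_distr_coco_russo_1d:
  fixes h \<theta> :: "nat \<Rightarrow> real"
  assumes h: "\<And>n. n \<ge> 1 \<Longrightarrow> h n \<noteq> 0" and \<theta>: "\<And>n. n \<ge> 1 \<Longrightarrow> \<theta> n \<noteq> 1"
  shows "spectral_distr
    (\<lambda>n. map_mat complex_of_real ((h n)^2 \<cdot>\<^sub>m coco_russo_1d n (h n) (\<theta> n)))
    (\<lambda>t::real. complex_of_real (2 - 2 * cos t)) {-pi..pi}"
proof -
  define M where "M n = map_mat complex_of_real ((h n)^2 \<cdot>\<^sub>m coco_russo_1d n (h n) (\<theta> n))" for n
  have dim: "dim_row (M n) = n + 1" "dim_col (M n) = n + 1" for n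
    by (simp_all add: M_def coco_russo_1d_def)
  have lim: "(\<lambda>n. (\<Sum>z\<in>#eigvals_mset (M n). F z) / of_nat (dim_row (M n))) \<longlonglongrightarrow>
      (LINT x|lebesgue_on {-pi..pi}. F (complex_of_real (2 - 2 * cos x))) /
        of_real (measure lebesgue {-pi..pi})" if F: "F \<in> C_c" for F
  proof -
    define G where "G t = F (complex_of_real (2 - 2 * cos t))" for t
    have contF: "continuous_on UNIV F" using F by (simp add: C_c_def)
    have cont: "continuous_on S G" for S
      unfolding G_def by (intro continuous_on_compose2[OF contF] continuous_intros) auto
    obtain B where B: "\<And>z. norm (F z) \<le> B" using C_c_bounded[OF F] by blast
    have "(LINT x|lebesgue_on {-pi..pi}. G x) = integral {-pi..pi} G"
      using lebesgue_integral_cbox_continuous[of "-pi" pi G] cont by simp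
    also have "\<dots> = 2 * integral {0..pi} G"
      using cont by (intro integral_even) (auto simp: G_def)
    finally have rhs: "(LINT x|lebesgue_on {-pi..pi}. G x) / of_real (measure lebesgue {-pi..pi}) =
        integral {0..pi} G / of_real pi"
      by simp
    have "(\<lambda>n. (\<Sum>z\<in>#eigvals_mset (M n). F z) / of_nat (n + 1)) \<longlonglongrightarrow> integral {0..pi} G / of_real pi"
    proof (rule tendsto_of_error_bound[where C = "4 * B"])
      fix \<epsilon> :: real assume \<epsilon>: "\<epsilon> > 0"
      have "uniformly_continuous_on {0..pi} G"
        by (intro compact_uniformly_continuous cont) simp
      then obtain \<delta> where \<delta>: "\<delta> > 0"
        "\<And>s t. s \<in> {0..pi} \<Longrightarrow> t \<in> {0..pi} \<Longrightarrow> \<bar>s - t\<bar> < \<delta> \<Longrightarrow> norm (G s - G t) < \<epsilon>"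
        using \<epsilon> unfolding uniformly_continuous_on_def dist_norm by (metis real_norm_def)
      \<comment> \<open>Once the cell width is below \<open>\<delta>\<close>, uniform continuity
        supplies the oscillation bound.\<close>
      have "\<forall>\<^sub>F n in sequentially. pi / real (n + 1) < \<delta>"
        using \<delta>(1) by real_asymp
      then show "\<forall>\<^sub>F n in sequentially. norm ((\<Sum>z\<in>#eigvals_mset (M n). F z) / of_nat (n + 1) -
          integral {0..pi} G / of_real pi) \<le> \<epsilon> + 4 * B / real (n + 1)"
        using eventually_ge_at_top[of 1]
      proof eventually_elim
        case (elim n)
        have M_eq: "M n = ghost_tridiagonal n ((h n)\<^sup>2 * \<theta> n) ((h n)\<^sup>2 * (1 - \<theta> n)) 2"
          unfolding M_def using h elim by (intro coco_russo_1d_eq_ghost_tridiagonal) auto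
        have "(h n)\<^sup>2 * (1 - \<theta> n) \<noteq> 0"
          using h[OF elim(2)] \<theta>[OF elim(2)] by simp
        moreover have "norm (G s - G t) \<le> \<epsilon>"
          if "s \<in> {0..pi}" "t \<in> {0..pi}" "\<bar>s - t\<bar> \<le> pi / real (n + 1)" for s t
          using \<delta>(2)[of s t] that elim(1) by simp
        ultimately show ?case
          using cont[of "{0..pi}"] unfolding G_def M_eq
          by (intro ghost_tridiagonal_average_error elim B)
      qed
    qed
    then show ?thesis
      unfolding rhs[unfolded G_def, symmetric] dim G_def by (simp add: rhs[unfolded G_def])
  qed
  have "filterlim (\<lambda>n. dim_row (M n)) at_top sequentially"
    unfolding dim by (rule filterlim_add_const_nat_at_top)
  moreover have "(\<lambda>t. complex_of_real (2 - 2 * cos t)) \<in> borel_measurable (lebesgue_on {-pi..pi})"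
    by (intro continuous_imp_measurable_on_sets_lebesgue continuous_intros) auto
  ultimately show ?thesis
    using lim unfolding spectral_distr_def M_def[symmetric] by (simp add: dim)
qed

lemma sum_mset_image_mset_sum:
  "(\<Sum>z\<in>#(\<Sum>k<n. R k). F z) = (\<Sum>k<(n::nat). \<Sum>z\<in>#R k. F z)"
  by (induction n) auto

lemma spectral_distr_coco_russo_2d:
  fixes h \<theta> :: "nat \<Rightarrow> real"
  assumes h: "\<And>n. n \<ge> 1 \<Longrightarrow> h n \<noteq> 0" and \<theta>: "\<And>n. n \<ge> 1 \<Longrightarrow> \<theta> n \<noteq> 1"
  shows "spectral_distr
    (\<lambda>n. map_mat complex_of_real ((h n)^2 \<cdot>\<^sub>m coco_russo_2d n (h n) (\<theta> n)))
    (\<lambda>(t1::real, t2::real). complex_of_real (4 - 2 * cos t1 - 2 * cos t2))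
    ({-pi..pi} \<times> {-pi..pi})"
proof -
  define M where "M n = map_mat complex_of_real ((h n)^2 \<cdot>\<^sub>m coco_russo_2d n (h n) (\<theta> n))" for n
  define f where "f = (\<lambda>(s::real, t::real). complex_of_real (4 - 2 * cos s - 2 * cos t))"
  have dim: "dim_row (M n) = n * (n + 1)" "dim_col (M n) = n * (n + 1)" for n
    by (simp_all add: M_def coco_russo_2d_def)
  have box: "{-pi..pi} \<times> {-pi..pi} = cbox (-pi, -pi) (pi, pi)"
    by (simp add: cbox_Pair_eq)
  have cont_f: "continuous_on S f" for S
    unfolding f_def case_prod_unfold by (intro continuous_intros)
  have content: "measure lebesgue (cbox (-pi, -pi) (pi, pi)) = 4 * pi\<^sup>2"
    by (simp add: content_Pair power2_eq_square)
  have lim: "(\<lambda>n. (\<Sum>z\<in>#eigvals_mset (M n). F z) / of_nat (dim_row (M n))) \<longlonglongrightarrow>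
      (LINT x|lebesgue_on (cbox (-pi, -pi) (pi, pi)). F (f x)) /
        of_real (measure lebesgue (cbox (-pi, -pi) (pi, pi)))" if F: "F \<in> C_c" for F
  proof -
    define \<Phi> where "\<Phi> s t = F (f (s, t))" for s t
    \<comment> \<open>\<open>H s\<close> is the limit of the one-dimensional averages for
      \<open>\<kappa> = 4 - 2 * cos s\<close>.\<close>
    define H where "H s = integral {0..pi} (\<Phi> s) / of_real pi" for s
    have contF: "continuous_on UNIV F" using F by (simp add: C_c_def)
    have cont: "continuous_on S (\<lambda>x. F (f x))" for S
      by (rule continuous_on_compose2[OF contF cont_f]) auto
    have cont_\<Phi>: "continuous_on S (\<Phi> s)" for S s
      unfolding \<Phi>_def f_def prod.case by (intro continuous_on_compose2[OF contF] continuous_intros) auto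
    have cont_int: "continuous_on S (\<lambda>s. integral {a..b} (\<Phi> s))" for S a b
    proof -
      have "continuous_on (S \<times> cbox a b) (\<lambda>(s, t). \<Phi> s t)"
        using cont[of "S \<times> cbox a b"] by (simp add: \<Phi>_def case_prod_unfold)
      from integral_continuous_on_param[OF this] show ?thesis by simp
    qed
    have cont_H: "continuous_on S H" for S
      unfolding H_def by (intro continuous_intros cont_int) simp
    obtain B where B: "\<And>z. norm (F z) \<le> B" using C_c_bounded[OF F] by blast
    have H_bound: "norm (H s) \<le> B" for s
      using integral_bound[of 0 pi "\<Phi> s" B] cont_\<Phi> B
      by (simp add: H_def \<Phi>_def norm_divide field_simps)
    have "(LINT x|lebesgue_on (cbox (-pi, -pi) (pi, pi)). F (f x)) =
        integral (cbox (-pi, -pi) (pi, pi)) (\<lambda>x. F (f x))"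
      by (intro lebesgue_integral_cbox_continuous cont)
    also have "\<dots> = integral {-pi..pi} (\<lambda>s. integral {-pi..pi} (\<Phi> s))"
      using integral_prod_continuous[OF cont, of "-pi" "-pi" pi pi] by (simp add: \<Phi>_def[abs_def])
    also have "\<dots> = 2 * integral {0..pi} (\<lambda>s. integral {-pi..pi} (\<Phi> s))"
      by (intro integral_even cont_int) (auto simp: \<Phi>_def[abs_def] f_def)
    also have "(\<lambda>s. integral {-pi..pi} (\<Phi> s)) = (\<lambda>s. 2 * of_real pi * H s)"
    proof
      show "integral {-pi..pi} (\<Phi> s) = 2 * of_real pi * H s" for s
        using integral_even[of pi "\<Phi> s", OF cont_\<Phi>] by (simp add: H_def) (simp add: \<Phi>_def f_def)
    qed
    finally have rhs: "(LINT x|lebesgue_on (cbox (-pi, -pi) (pi, pi)). F (f x)) /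
        of_real (measure lebesgue (cbox (-pi, -pi) (pi, pi))) = integral {0..pi} H / of_real pi"
      unfolding content by (simp add: power2_eq_square)
    have "(\<lambda>n. (\<Sum>z\<in>#eigvals_mset (M n). F z) / of_nat (n * (n + 1))) \<longlonglongrightarrow> integral {0..pi} H / of_real pi"
    proof (rule tendsto_of_error_bound[where C = "6 * B"])
      fix \<epsilon>' :: real assume "\<epsilon>' > 0"
      \<comment> \<open>Half of the tolerance goes to the averages within the modes, half to the
        outer Riemann sum.\<close>
      define \<epsilon> where "\<epsilon> = \<epsilon>' / 2"
      have \<epsilon>: "\<epsilon> > 0" using \<open>\<epsilon>' > 0\<close> by (simp add: \<epsilon>_def)
      have "uniformly_continuous_on ({0..pi} \<times> {0..pi}) (\<lambda>x. F (f x))"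
        by (intro compact_uniformly_continuous cont compact_Times) simp_all
      then obtain \<delta> where \<delta>: "\<delta> > 0" "\<And>x y. x \<in> {0..pi} \<times> {0..pi} \<Longrightarrow> y \<in> {0..pi} \<times> {0..pi} \<Longrightarrow>
          dist x y < \<delta> \<Longrightarrow> norm (F (f x) - F (f y)) < \<epsilon>"
        using \<epsilon> unfolding uniformly_continuous_on_def dist_norm by metis
      have osc1: "norm (\<Phi> s r - \<Phi> t r) \<le> \<epsilon>" and osc2: "norm (\<Phi> r s - \<Phi> r t) \<le> \<epsilon>"
        if "r \<in> {0..pi}" "s \<in> {0..pi}" "t \<in> {0..pi}" "\<bar>s - t\<bar> < \<delta>" for r s t
        using \<delta>(2)[of "(s, r)" "(t, r)"] \<delta>(2)[of "(r, s)" "(r, t)"] that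
        by (auto simp: \<Phi>_def dist_Pair_Pair dist_real_def)
      \<comment> \<open>\<open>H\<close> averages \<open>\<Phi>\<close> over the second angle and so
        inherits its oscillation bound in the first.\<close>
      have osc_H: "norm (H s - H t) \<le> \<epsilon>"
        if "s \<in> {0..pi}" "t \<in> {0..pi}" "\<bar>s - t\<bar> < \<delta>" for s t
      proof -
        have "integral {0..pi} (\<Phi> s) - integral {0..pi} (\<Phi> t) = integral {0..pi} (\<lambda>r. \<Phi> s r - \<Phi> t r)"
          by (intro integral_diff[symmetric] integrable_continuous_real cont_\<Phi>)
        also have "norm \<dots> \<le> \<epsilon> * (pi - 0)"
          using that osc1 by (intro integral_bound continuous_on_diff cont_\<Phi>) auto
        finally show ?thesis
          by (simp add: H_def norm_divide field_simps flip: diff_divide_distrib)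
      qed
      have "\<forall>\<^sub>F n in sequentially. pi / real (n + 1) < \<delta>"
        using \<delta>(1) by real_asymp
      then show "\<forall>\<^sub>F n in sequentially. norm ((\<Sum>z\<in>#eigvals_mset (M n). F z) / of_nat (n * (n + 1)) -
          integral {0..pi} H / of_real pi) \<le> \<epsilon>' + 6 * B / real (n + 1)"
        using eventually_ge_at_top[of 1]
      proof eventually_elim
        case (elim n)
        define u where "u j = real j * pi / real (n + 1)" for j
        define A where "A k = ghost_tridiagonal n ((h n)\<^sup>2 * \<theta> n) ((h n)\<^sup>2 * (1 - \<theta> n)) (4 - 2 * cos (u (k + 1)))" for k
        define a where "a k = (\<Sum>z\<in>#eigvals_mset (A k). F z) / of_nat (n + 1)" for k
        \<comment> \<open>The modes sample \<open>H\<close> at the \<open>n\<close> points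
          \<open>u 1\<close> to \<open>u n\<close>, while the mesh has \<open>n + 1\<close> cells.
          The sample at \<open>u 0\<close> is added below, and \<open>err2\<close> pays for it and
          for the change of divisor.\<close>
        define X where "X = (\<Sum>k<n. H (u (k + 1)))"
        have u_range: "u j \<in> {0..pi}" if "j \<le> n + 1" for j
          using that mult_right_mono[of "real j" "real (n + 1)" pi] by (simp add: u_def field_simps)
        have "eigvals_mset (M n) = (\<Sum>k<n. eigvals_mset (A k))"
          unfolding M_def A_def u_def using h elim by (intro eigvals_coco_russo_2d) auto
        then have "(\<Sum>z\<in>#eigvals_mset (M n). F z) = (\<Sum>k<n. \<Sum>z\<in>#eigvals_mset (A k). F z)"
          by (simp only: sum_mset_image_mset_sum)
        then have sum_eq: "(\<Sum>z\<in>#eigvals_mset (M n). F z) / of_nat (n * (n + 1)) = (\<Sum>k<n. a k) / of_nat n"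
          by (simp only: a_def sum_divide_distrib[symmetric]) (simp add: field_simps)
        have a_err: "norm (a k - H (u (k + 1))) \<le> \<epsilon> + 4 * B / real (n + 1)" if "k < n" for k
        proof -
          have \<Phi>_eq: "\<Phi> (u (k + 1)) = (\<lambda>t. F (of_real (4 - 2 * cos (u (k + 1)) - 2 * cos t)))"
            by (simp add: \<Phi>_def[abs_def] f_def)
          have "(h n)\<^sup>2 * (1 - \<theta> n) \<noteq> 0"
            using h[OF elim(2)] \<theta>[OF elim(2)] by simp
          moreover have "norm (\<Phi> (u (k + 1)) s - \<Phi> (u (k + 1)) t) \<le> \<epsilon>"
            if "s \<in> {0..pi}" "t \<in> {0..pi}" "\<bar>s - t\<bar> \<le> pi / real (n + 1)" for s t
            using osc2[of "u (k + 1)" s t] u_range[of "k + 1"] \<open>k < n\<close> that elim(1) by simp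
          ultimately show ?thesis
            unfolding a_def A_def H_def using cont_\<Phi>[of "{0..pi}" "u (k + 1)"] unfolding \<Phi>_eq
            by (intro ghost_tridiagonal_average_error elim B)
        qed
        have "norm ((\<Sum>k<n. a k) / of_nat n - X / of_nat n) = norm (\<Sum>k<n. a k - H (u (k + 1))) / real n"
          by (simp add: X_def sum_subtractf norm_divide flip: diff_divide_distrib)
        also have "\<dots> \<le> (\<Sum>k<n. \<epsilon> + 4 * B / real (n + 1)) / real n"
          using a_err by (intro divide_right_mono sum_norm_le) auto
        also have "\<dots> = \<epsilon> + 4 * B / real (n + 1)"
          using elim by simp
        finally have err1: "norm ((\<Sum>k<n. a k) / of_nat n - X / of_nat n) \<le> \<epsilon> + 4 * B / real (n + 1)" .
        have sum_H: "(\<Sum>j<n + 1. H (u j)) = H (u 0) + X"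
          unfolding X_def by (simp add: sum.lessThan_Suc_shift del: sum.lessThan_Suc)
        obtain Y where Y: "X = of_nat n * Y"
          using elim(2) by (metis nonzero_mult_div_cancel_left times_divide_eq_right of_nat_eq_0_iff not_one_le_zero)
        have "of_nat (n + 1) \<noteq> (0 :: complex)"
          by (simp only: of_nat_eq_0_iff)
        then have "X / of_nat n - (H (u 0) + X) / of_nat (n + 1) = (X / of_nat n - H (u 0)) / of_nat (n + 1)"
          using elim(2) by (simp add: Y divide_simps) (simp add: algebra_simps)
        also have "norm \<dots> \<le> (B + B) / real (n + 1)"
        proof -
          have "norm X \<le> (\<Sum>k<n. B)"
            unfolding X_def by (intro sum_norm_le H_bound)
          then have "norm (X / of_nat n) \<le> B"
            using elim by (simp add: norm_divide field_simps)
          then have "norm (X / of_nat n - H (u 0)) \<le> B + B"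
            by (intro order_trans[OF norm_triangle_ineq4] add_mono H_bound)
          then show ?thesis
            by (simp only: norm_divide norm_of_nat) (intro divide_right_mono, auto)
        qed
        finally have err2: "norm (X / of_nat n - (H (u 0) + X) / of_nat (n + 1)) \<le> (B + B) / real (n + 1)" .
        have err3: "norm ((H (u 0) + X) / of_nat (n + 1) - integral {0..pi} H / of_real pi) \<le> \<epsilon>"
          unfolding sum_H[symmetric]
        proof (rule riemann_sum_error[OF cont_H])
          show "norm (H s - H t) \<le> \<epsilon>" if "s \<in> {0..pi}" "t \<in> {0..pi}" "\<bar>s - t\<bar> \<le> pi / real (n + 1)" for s t
            using osc_H that elim(1) by simp
        qed (auto simp: u_def divide_right_mono mult_right_mono)
        \<comment> \<open>The three errors are chained: \<open>\<epsilon>\<close> occurs twice, and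
          \<open>4 * B\<close> and \<open>2 * B\<close> give \<open>6 * B\<close>.\<close>
        have "norm ((\<Sum>k<n. a k) / of_nat n - integral {0..pi} H / of_real pi) \<le>
            (\<epsilon> + 4 * B / real (n + 1)) + ((B + B) / real (n + 1) + \<epsilon>)"
          using norm_triangle_mono[OF err1 norm_triangle_mono[OF err2 err3]] by simp
        also have "\<dots> = \<epsilon>' + 6 * B / real (n + 1)"
          by (simp add: \<epsilon>_def add_divide_distrib)
        finally show ?case
          unfolding sum_eq .
      qed
    qed
    then show ?thesis
      unfolding rhs dim .
  qed
  have "filterlim (\<lambda>n. dim_row (M n)) at_top sequentially"
    unfolding dim by real_asymp
  moreover have "f \<in> borel_measurable (lebesgue_on (cbox (-pi, -pi) (pi, pi)))"
    by (intro continuous_imp_measurable_on_sets_lebesgue cont_f) auto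
  ultimately show ?thesis
    using lim content unfolding spectral_distr_def M_def[symmetric] f_def[symmetric] box by (simp add: dim)
qed

theorem theorem4:
  shows
    "(\<forall>(a::real) (b::real) (x0::nat \<Rightarrow> real) (x1::nat \<Rightarrow> real) (h::nat \<Rightarrow> real) (\<theta>::nat \<Rightarrow> real).
        a < b \<longrightarrow>
        (\<forall>n\<ge>1. x0 n < b \<and> h n = (b - x0 n) / (real n + 1) \<and> x1 n = x0 n + h n \<and>
               x0 n < a \<and> a < x1 n \<and> \<theta> n = (x1 n - a) / h n) \<longrightarrow>
        spectral_distr
          (\<lambda>n. map_mat complex_of_real ((h n)^2 \<cdot>\<^sub>m coco_russo_1d n (h n) (\<theta> n)))
          (\<lambda>t::real. complex_of_real (2 - 2 * cos t))
          {-pi..pi})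
     \<and>
     (\<forall>(a::nat \<Rightarrow> real) (h::nat \<Rightarrow> real) (\<theta>S::nat \<Rightarrow> real).
        (\<forall>n\<ge>1. h n = 1 / (real n + 1) \<and> 0 < a n \<and> a n < h n \<and> \<theta>S n = (h n - a n) / h n) \<longrightarrow>
        spectral_distr
          (\<lambda>n. map_mat complex_of_real ((h n)^2 \<cdot>\<^sub>m coco_russo_2d n (h n) (\<theta>S n)))
          (\<lambda>(t1::real, t2::real). complex_of_real (4 - 2 * cos t1 - 2 * cos t2))
          ({-pi..pi} \<times> {-pi..pi}))"
proof (intro conjI allI impI, goal_cases)
  case (1 a b x0 x1 h \<theta>)
  have "h n > 0" "\<theta> n < 1" if "n \<ge> 1" for n
  proof -
    from 1(2) that have *: "x0 n < b" "h n = (b - x0 n) / (real n + 1)" "x1 n = x0 n + h n"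
      "x0 n < a" "\<theta> n = (x1 n - a) / h n"
      by auto
    then show pos: "h n > 0" by simp
    \<comment> \<open>From \<open>x0 n < a\<close> follows \<open>x1 n - a < h n\<close>.\<close>
    show "\<theta> n < 1" using pos *(3,4,5) by (simp add: divide_less_eq)
  qed
  then show ?case
    by (intro spectral_distr_coco_russo_1d) (metis less_irrefl)+
next
  case (2 a h \<theta>S)
  have "h n > 0" "\<theta>S n < 1" if "n \<ge> 1" for n
  proof -
    from 2 that have *: "0 < a n" "a n < h n" "\<theta>S n = (h n - a n) / h n"
      by auto
    then show "h n > 0" by simp
    with * show "\<theta>S n < 1" by simp
  qed
  then show ?case
    by (intro spectral_distr_coco_russo_2d) (metis less_irrefl)+
qed

end
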